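(* For every integer $n\ge 0$, the Askey-Wilson moments satisfy $$2^n\mu_n(a,b,c,d;q) =\sum_{m=0}^n \frac{(ab,ac,ad;q)_m}{(abcd;q)_m} (-q)^m \sum_{s=0}^{n+1} \left(\binom{n}{s} - \binom{n}{s-1}\right) \sum_{p=0}^{n-2s-m} a^{-n+2s+2p} \begin{bmatrix} m+p\\ m\end{bmatrix}_q \begin{bmatrix} n-2s-p\\ m\end{bmatrix}_q q^{(-n+2s+p)m+\binom{m}{2}}.$$
   Context: Let $a,b,c,d,q$ be indeterminates (generic parameters). The monic Askey-Wilson polynomials $P_n(x)=P_n(x;a,b,c,d;q)$ are defined by $P_{-1}=0$, $P_0=1$, $P_{n+1}=(x-b_n)P_n-\lambda_nP_{n-1}$, with $b_n=\frac12(a+a^{-1}-(A_n+C_n))$, $\lambda_n=\frac14A_{n-1}C_n$, where $$A_n=\frac{(1-abq^n)(1-acq^n)(1-adq^n)(1-abcdq^{n-1})}{a(1-abcdq^{2n-1})(1-abcdq^{2n})},\quad C_n=\frac{a(1-q^n)(1-bcq^{n-1})(1-bdq^{n-1})(1-cdq^{n-1})}{(1-abcdq^{2n-2})(1-abcdq^{2n-1})}$$ (for $n=0$ the common factor $1-abcdq^{-1}$ in $A_0$ is cancelled, and $C_0=0$). The moment $\mu_n(a,b,c,d;q)=L(x^n)$, where $L$ is the unique linear functional on polynomials in $x$ with $L(1)=1$ and $L(P_n)=0$ for all $n\ge1$ (so that $L(P_mP_n)=0$ for $m\neq n$). It is a rational function of $a,b,c,d,q$, symmetric in $a,b,c,d$.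 Notation: $(x;q)_m=\prod_{i=0}^{m-1}(1-xq^i)$, $(x_1,\dots,x_r;q)_m=\prod_i(x_i;q)_m$, and $\begin{bmatrix} n\\k\end{bmatrix}_q=\frac{(q;q)_n}{(q;q)_k(q;q)_{n-k}}$ for $0\le k\le n$. Binomial coefficients $\binom nk$ with $k<0$ or $k>n$ are $0$. A sum whose upper limit is smaller than its lower limit is empty. *)

theory Defs
  imports Complex_Main "HOL-Computational_Algebra.Polynomial"
begin

definition qpoch :: "'a::field \<Rightarrow> 'a \<Rightarrow> nat \<Rightarrow> 'a" where
  "qpoch x q m = (\<Prod>i<m. 1 - x * q ^ i)"

text \<open>Meaningful for \<open>k \<le> n\<close> and \<open>q\<close> not a root of unity; nothing is claimed outside this range.\<close>

definition qbinom :: "'a::field \<Rightarrow> nat \<Rightarrow> nat \<Rightarrow> 'a" where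
  "qbinom q n k = qpoch q q n / (qpoch q q k * qpoch q q (n - k))"

text \<open>Binomial coefficient with an integer lower index, zero unless \<open>0 \<le> k \<le> n\<close>.\<close>

definition zbinom :: "nat \<Rightarrow> int \<Rightarrow> int" where
  "zbinom n k = (if k < 0 then 0 else int (n choose nat k))"

text \<open>For \<open>n = 0\<close> the factor \<open>1 - abcd q\<^sup>-\<^sup>1\<close> common to numerator and denominator is cancelled.\<close>

definition AW_A :: "'a::field \<Rightarrow> 'a \<Rightarrow> 'a \<Rightarrow> 'a \<Rightarrow> 'a \<Rightarrow> nat \<Rightarrow> 'a" where
  "AW_A a b c d q n =
    (if n = 0 then (1 - a*b) * (1 - a*c) * (1 - a*d) / (a * (1 - a*b*c*d))
     else (1 - a*b * q^n) * (1 - a*c * q^n) * (1 - a*d * q^n) * (1 - a*b*c*d * q^(n - 1)) /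
          (a * (1 - a*b*c*d * q^(2*n - 1)) * (1 - a*b*c*d * q^(2*n))))"

definition AW_C :: "'a::field \<Rightarrow> 'a \<Rightarrow> 'a \<Rightarrow> 'a \<Rightarrow> 'a \<Rightarrow> nat \<Rightarrow> 'a" where
  "AW_C a b c d q n =
    (if n = 0 then 0
     else a * (1 - q^n) * (1 - b*c * q^(n - 1)) * (1 - b*d * q^(n - 1)) * (1 - c*d * q^(n - 1)) /
          ((1 - a*b*c*d * q^(2*n - 2)) * (1 - a*b*c*d * q^(2*n - 1))))"

definition AW_b :: "'a::field \<Rightarrow> 'a \<Rightarrow> 'a \<Rightarrow> 'a \<Rightarrow> 'a \<Rightarrow> nat \<Rightarrow> 'a" where
  "AW_b a b c d q n = (a + inverse a - (AW_A a b c d q n + AW_C a b c d q n)) / 2"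

text \<open>Only used for \<open>n \<ge> 1\<close>.\<close>

definition AW_lambda :: "'a::field \<Rightarrow> 'a \<Rightarrow> 'a \<Rightarrow> 'a \<Rightarrow> 'a \<Rightarrow> nat \<Rightarrow> 'a" where
  "AW_lambda a b c d q n = AW_A a b c d q (n - 1) * AW_C a b c d q n / 4"

text \<open>\<open>[:- \<beta>, 1:]\<close> is the polynomial \<open>x - \<beta>\<close>; the second equation is the recurrence at \<open>n = 0\<close>,
  where \<open>P\<^sub>-\<^sub>1 = 0\<close>.\<close>

fun AW_poly :: "'a::field \<Rightarrow> 'a \<Rightarrow> 'a \<Rightarrow> 'a \<Rightarrow> 'a \<Rightarrow> nat \<Rightarrow> 'a poly" where
  "AW_poly a b c d q 0 = 1"
| "AW_poly a b c d q (Suc 0) = [:- AW_b a b c d q 0, 1:]"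
| "AW_poly a b c d q (Suc (Suc n)) =
     [:- AW_b a b c d q (Suc n), 1:] * AW_poly a b c d q (Suc n)
     - smult (AW_lambda a b c d q (Suc n)) (AW_poly a b c d q n)"

definition is_AW_functional ::
    "'a::field \<Rightarrow> 'a \<Rightarrow> 'a \<Rightarrow> 'a \<Rightarrow> 'a \<Rightarrow> ('a poly \<Rightarrow> 'a) \<Rightarrow> bool" where
  "is_AW_functional a b c d q L \<longleftrightarrow>
     Vector_Spaces.linear smult (*) L \<and> L 1 = 1 \<and> (\<forall>n\<ge>1. L (AW_poly a b c d q n) = 0)"

definition AW_functional :: "'a::field \<Rightarrow> 'a \<Rightarrow> 'a \<Rightarrow> 'a \<Rightarrow> 'a \<Rightarrow> 'a poly \<Rightarrow> 'a" where
  "AW_functional a b c d q = (THE L. is_AW_functional a b c d q L)"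

definition AW_moment :: "nat \<Rightarrow> 'a::field \<Rightarrow> 'a \<Rightarrow> 'a \<Rightarrow> 'a \<Rightarrow> 'a \<Rightarrow> 'a" where
  "AW_moment n a b c d q = AW_functional a b c d q (monom 1 n)"

text \<open>The definite description above is well defined.\<close>

lemma AW_poly_monic:
  "degree (AW_poly a b c d q n) = n \<and> lead_coeff (AW_poly a b c d q n) = 1"
proof (induction n rule: induct_nat_012)
  case (ge2 n)
  let ?P = "AW_poly a b c d q"
  let ?r = "[:- AW_b a b c d q (Suc n), 1:] * ?P (Suc n)"
  let ?t = "smult (AW_lambda a b c d q (Suc n)) (?P n)"
  have nz: "?P (Suc n) \<noteq> 0" using ge2 by auto
  have lc: "lead_coeff (?P (Suc n)) = 1" using ge2 by blast
  have dr: "degree ?r = Suc (Suc n)" using ge2 nz by (subst degree_mult_eq) auto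
  have lr: "lead_coeff ?r = 1" by (subst lead_coeff_mult) (simp only: lc, simp)
  have dt: "degree ?t < degree ?r"
    using dr ge2 degree_smult_le[of "AW_lambda a b c d q (Suc n)" "?P n"]
    by (simp del: mult_pCons_left)
  have "degree (?r - ?t) = degree ?r"
    using dt by (metis degree_add_eq_left degree_minus diff_conv_add_uminus)
  moreover have "coeff ?t (degree ?r) = 0" using dt by (rule coeff_eq_0)
  ultimately show ?case
    using dr lr by (simp del: mult_pCons_left)
qed auto

lemma linear_smult_iff:
  "Vector_Spaces.linear smult (*) (L :: 'a::field poly \<Rightarrow> 'a) \<longleftrightarrow>
     (\<forall>p r. L (p + r) = L p + L r) \<and> (\<forall>x p. L (smult x p) = x * L p)"
proof -
  have "vector_space (smult :: 'a \<Rightarrow> _)"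
    by unfold_locales (auto simp: smult_add_right smult_add_left)
  moreover have "vector_space ((*) :: 'a \<Rightarrow> 'a \<Rightarrow> 'a)"
    by unfold_locales (auto simp: algebra_simps)
  ultimately show ?thesis
    by (auto simp: Vector_Spaces.linear_iff)
qed

fun AW_mom_rec :: "(nat \<Rightarrow> 'a::field poly) \<Rightarrow> nat \<Rightarrow> 'a" where
  "AW_mom_rec P n = (if n = 0 then 1 else - (\<Sum>i\<in>{..<n}. coeff (P n) i * AW_mom_rec P i))"

declare AW_mom_rec.simps [simp del]

lemma AW_functional_ex1: "\<exists>!L. is_AW_functional a b c d q L"
proof (rule ex_ex1I)
  let ?P = "AW_poly a b c d q"
  define m where "m = AW_mom_rec ?P"
  define L where "L p = (\<Sum>i\<le>degree p. coeff p i * m i)" for p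
  have L: "L p = (\<Sum>i\<le>N. coeff p i * m i)" if "degree p \<le> N" for p N
    unfolding L_def using that
    by (intro sum.mono_neutral_left) (auto simp: coeff_eq_0)
  have "L (p + r) = L p + L r" for p r
  proof -
    define N where "N = max (degree p) (degree r)"
    have "degree (p + r) \<le> N" "degree p \<le> N" "degree r \<le> N"
      unfolding N_def using degree_add_le_max[of p r] by auto
    then show ?thesis by (simp add: L algebra_simps sum.distrib)
  qed
  moreover have "L (smult x p) = x * L p" for x p
    by (simp add: L[OF degree_smult_le] L_def sum_distrib_left mult.assoc)
  moreover have "L 1 = 1" by (simp add: L_def m_def AW_mom_rec.simps)
  moreover have "L (?P n) = 0" if "n \<ge> 1" for n
  proof -
    have dg: "degree (?P n) = n" and lc: "coeff (?P n) n = 1"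
      using AW_poly_monic[of a b c d q n] by auto
    have "L (?P n) = (\<Sum>i<n. coeff (?P n) i * m i) + m n"
      using dg lc by (simp add: L_def flip: lessThan_Suc_atMost)
    also have "m n = - (\<Sum>i<n. coeff (?P n) i * m i)"
      unfolding m_def using that by (subst AW_mom_rec.simps) simp
    finally show ?thesis by simp
  qed
  ultimately show "\<exists>L. is_AW_functional a b c d q L"
    unfolding is_AW_functional_def linear_smult_iff by blast
next
  let ?P = "AW_poly a b c d q"
  fix L L'
  assume LL: "is_AW_functional a b c d q L" "is_AW_functional a b c d q L'"
  have add: "L (p + r) = L p + L r" "L' (p + r) = L' p + L' r"
    and sc: "L (smult x p) = x * L p" "L' (smult x p) = x * L' p" for p r x
    using LL unfolding is_AW_functional_def linear_smult_iff by auto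
  have P: "L (?P n) = L' (?P n)" for n
    using LL by (cases "n = 0") (auto simp: is_AW_functional_def)
  have "L p = L' p" for p
  proof (induction "degree p" arbitrary: p rule: less_induct)
    case less
    let ?n = "degree p"
    define r where "r = p - smult (lead_coeff p) (?P ?n)"
    have p: "p = r + smult (lead_coeff p) (?P ?n)" by (simp add: r_def)
    have "L r = L' r"
    proof (cases "?n = 0")
      case True
      then obtain x where "p = [:x:]" by (rule degree_eq_zeroE)
      then have "r = 0" by (simp add: r_def)
      then show ?thesis using sc[of 0 0] by simp
    next
      case False
      have "coeff r ?n = 0" "degree r \<le> ?n"
        using AW_poly_monic[of a b c d q ?n] degree_smult_le[of "lead_coeff p" "?P ?n"]
        by (auto simp: r_def intro!: degree_diff_le)
      then have "degree r < ?n"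
        using False by (metis degree_0 leading_coeff_0_iff le_neq_implies_less neq0_conv)
      then show ?thesis by (rule less)
    qed
    then show ?case using p add sc P by metis
  qed
  then show "L = L'" by blast
qed

lemma AW_functional_is: "is_AW_functional a b c d q (AW_functional a b c d q)"
  unfolding AW_functional_def by (rule theI'[OF AW_functional_ex1])

end

theory Submission
  imports Defs "HOL-Computational_Algebra.Formal_Power_Series"
begin

text \<open>With \<open>x = (z + 1/z) / 2\<close> let \<open>\<phi>\<^sub>k(x) = (az, a/z; q)\<^sub>k\<close>. The monic Askey-Wilson polynomial is
  the terminating \<open>\<^sub>4\<phi>\<^sub>3\<close> series in the \<open>\<phi>\<^sub>k\<close>; since \<open>L(P\<^sub>n) = 0\<close> for \<open>n \<ge> 1\<close>, a
  telescoping sum gives inductively \<open>L(\<phi>\<^sub>m) = (ab, ac, ad; q)\<^sub>m / (abcd; q)\<^sub>m\<close>. On the other hand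
  \<open>(2x)\<^sup>n\<close> is a combination of Chebyshev polynomials \<open>U\<^sub>n\<^sub>-\<^sub>2\<^sub>s\<close> with ballot numbers as coefficients, and
  the generating function \<open>\<Sum>\<^sub>N U\<^sub>N t\<^sup>N = 1 / (1 - 2xt + t\<^sup>2)\<close> expands in the \<open>\<phi>\<^sub>m\<close> with coefficients
  proportional to \<open>t\<^sup>m / \<Prod>\<^sub>i\<^sub>\<le>\<^sub>m (1 - a q\<^sup>i t) (1 - t / (a q\<^sup>i))\<close>, which the \<open>q\<close>-binomial theorem makes
  explicit.\<close>

unbundle fps_syntax

section \<open>Finite \<open>q\<close>-shifted factorials\<close>

lemma qpoch_0 [simp]: "qpoch x q 0 = 1"
  by (simp add: qpoch_def)

lemma qpoch_Suc: "qpoch x q (Suc m) = qpoch x q m * (1 - x * q ^ m)"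
  by (simp add: qpoch_def)

lemma qpoch_Suc_shift: "qpoch x q (Suc m) = (1 - x) * qpoch (x * q) q m"
  unfolding qpoch_def by (subst prod.lessThan_Suc_shift) (simp add: mult.assoc)

lemma qpoch_add: "qpoch x q (m + k) = qpoch x q m * qpoch (x * q ^ m) q k"
  by (induction k) (simp_all add: qpoch_Suc power_add mult.assoc)

lemma qpoch_nonzero: "(\<And>i. i < m \<Longrightarrow> x * q ^ i \<noteq> 1) \<Longrightarrow> qpoch x q m \<noteq> 0"
  by (auto simp: qpoch_def)

text \<open>The factor with index \<open>n\<close> is 0. This is what makes the series for
  \<open>P_n\<close> terminate.\<close>

lemma qpoch_inverse_power_eq_0:
  assumes "q \<noteq> 0" "n < k"
  shows "qpoch (inverse (q ^ n)) q k = 0"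
proof -
  have "inverse (q ^ n) * q ^ n = 1" using assms by simp
  then have "\<exists>i\<in>{..<k}. 1 - inverse (q ^ n) * q ^ i = 0"
    using assms by (intro bexI[of _ n]) auto
  then show ?thesis unfolding qpoch_def by (intro prod_zero) auto
qed

lemma qpoch_self_nonzero:
  assumes "\<And>k::nat. k \<ge> 1 \<Longrightarrow> q ^ k \<noteq> 1"
  shows "qpoch q q m \<noteq> 0"
proof (rule qpoch_nonzero)
  show "q * q ^ i \<noteq> 1" for i using assms[of "Suc i"] by simp
qed

section \<open>Expansion of the Askey-Wilson polynomials in the basis \<open>aw_phi\<close>\<close>

text \<open>Each factor is (1 - a z q^i)(1 - a q^i / z) rewritten in x by z + 1/z = 2x, so that z
  itself never appears.\<close>

definition aw_phi :: "'a::field \<Rightarrow> 'a \<Rightarrow> nat \<Rightarrow> 'a poly" where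
  "aw_phi a q m = (\<Prod>i<m. [:1 + a\<^sup>2 * q ^ (2 * i), - 2 * a * q ^ i:])"

lemma aw_phi_0 [simp]: "aw_phi a q 0 = 1"
  by (simp add: aw_phi_def)

text \<open>The last factor of \<open>aw_phi a q (Suc k)\<close> is 1 + y^2 - 2xy with y = a q^k.
  Solving for 2x shows that multiplication by x is bidiagonal in this basis.\<close>

lemma x_mult_aw_phi:
  fixes a q :: "'a::field_char_0"
  assumes "a \<noteq> 0" "q \<noteq> 0"
  shows "2 * x * poly (aw_phi a q k) x =
    (a * q ^ k + inverse (a * q ^ k)) * poly (aw_phi a q k) x
      - inverse (a * q ^ k) * poly (aw_phi a q (Suc k)) x"
proof -
  have phi: "poly (aw_phi a q (Suc k)) x =
    poly (aw_phi a q k) x * (1 + (a * q ^ k)\<^sup>2 - 2 * x * (a * q ^ k))"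
  proof -
    have "(a * q ^ k)\<^sup>2 = a\<^sup>2 * q ^ (2 * k)" by (simp only: power_mult_distrib power_even_eq)
    then show ?thesis by (simp only: aw_phi_def prod.lessThan_Suc poly_mult) simp
  qed
  have h: "2 * x * P = (y + inverse y) * P - inverse y * (P * (1 + y\<^sup>2 - 2 * x * y))"
    if "y \<noteq> 0" for y P :: 'a
  proof -
    have "inverse y * (P * (1 + y\<^sup>2 - 2 * x * y))
      = inverse y * P + (inverse y * y) * (y * P) - (inverse y * y) * (2 * x * P)"
      by (simp only: algebra_simps power2_eq_square mult_1_left)
    also have "inverse y * y = 1" using that by simp
    finally show ?thesis by (simp only: distrib_right) (simp add: mult.commute mult.left_commute)
  qed
  show ?thesis unfolding phi using assms by (intro h) simp
qed

text \<open>The coefficient of \<open>\<phi>\<^sub>k\<close> in \<open>P\<^sub>n\<close> is \<open>aw_kappa\<close> times \<open>aw_e\<close> below. The factors \<open>(ab, ac, ad; q)\<^sub>k\<close> in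
  the denominator of the usual \<open>\<^sub>4\<phi>\<^sub>3\<close> may vanish, so they are cancelled in \<open>aw_kappa\<close> against the
  leading coefficient \<open>(ab, ac, ad; q)\<^sub>n\<close>.\<close>

definition aw_kappa :: "'a::field \<Rightarrow> 'a \<Rightarrow> 'a \<Rightarrow> 'a \<Rightarrow> 'a \<Rightarrow> nat \<Rightarrow> nat \<Rightarrow> 'a" where
  "aw_kappa a b c d q n k =
     qpoch (a * b * q ^ k) q (n - k) * qpoch (a * c * q ^ k) q (n - k) * qpoch (a * d * q ^ k) q (n - k)
       / ((2 * a) ^ n * qpoch (a * b * c * d / q * q ^ n) q n)"

definition aw_e :: "'a::field \<Rightarrow> 'a \<Rightarrow> nat \<Rightarrow> nat \<Rightarrow> 'a" where
  "aw_e t q n k = qpoch (inverse (q ^ n)) q k * qpoch (t * q ^ n) q k * q ^ k / qpoch q q k"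

lemma aw_e_0 [simp]: "aw_e t q n 0 = 1"
  by (simp add: aw_e_def)

lemma aw_e_eq_0: "q \<noteq> 0 \<Longrightarrow> n < k \<Longrightarrow> aw_e t q n k = 0"
  by (simp add: aw_e_def qpoch_inverse_power_eq_0)

text \<open>Here \<open>N = q\<^sup>n\<close>, \<open>J = q\<^sup>j\<close>, \<open>t = abcd/q\<close>, and \<open>e\<^sub>1, e\<^sub>2\<close> are the elementary symmetric
  functions of \<open>b, c, d\<close>.\<close>

lemma AW_recurrence_polynomial:
  fixes a e1 e2 q t N J :: "'a::field"
  defines "f \<equiv> \<lambda>y. 1 - a * y * e1 + a^2 * y^2 * e2 - a^2 * y^3 * t * q"
  shows "- J * f N * (1 - t*N*J) - J * (N - J) * (a^2 * q - a^2 * N * e2 + a * N^2 * e1 * t - N^3 * t^2)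
    = (1 - t*N^2) * ((1 - a^2*q*J) * (N - J) * (1 - t*N*J) - N * f J)"
  unfolding f_def by (simp add: algebra_simps power2_eq_square power3_eq_cube)


text \<open>What remains of the three-term recurrence once common factors are cancelled. The
  parameters b, c, d enter only through \<open>e1\<close>, \<open>e2\<close> and their product
  \<open>w\<close>, and a w = t q eliminates \<open>w\<close>; clearing denominators then leaves the
  preceding polynomial identity.\<close>

lemma AW_recurrence_rational:
  fixes a b c d q t N J :: "'a::field"
  assumes nz: "a \<noteq> 0" "q \<noteq> 0" "N \<noteq> 0" "J \<noteq> 0" "t * N\<^sup>2 \<noteq> 1"
    and t: "t * q = a * b * c * d"
  shows "(1 - a*b*N) * (1 - a*c*N) * (1 - a*d*N) / (a * (1 - t*N\<^sup>2)) * (1 - t*N*J) * (- 1 / N)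
      - a * (1 - b*c*(N/q)) * (1 - b*d*(N/q)) * (1 - c*d*(N/q)) / (1 - t*N\<^sup>2) * q * (1 - J/N)
    = (1 - a\<^sup>2*q*J) * (1 - J/N) * (1 - t*N*J) / (a*J)
      - (1 - a*b*J) * (1 - a*c*J) * (1 - a*d*J) / (a*J)"
proof -
  define e1 e2 where "e1 = b + c + d" and "e2 = b*c + b*d + c*d"
  define f where "f = (\<lambda>y. 1 - a * y * e1 + a^2 * y^2 * e2 - a^2 * y^3 * t * q)"
  define w M where "w = b * c * d" and "M = N / q"
  have aw: "a * w = t * q" and N: "N = M * q"
    using t nz by (simp_all add: w_def M_def mult.assoc)
  have f: "(1 - a*b*y) * (1 - a*c*y) * (1 - a*d*y) = f y" for y
  proof -
    have "(1 - a*b*y) * (1 - a*c*y) * (1 - a*d*y) = 1 - a * y * e1 + a^2 * y^2 * e2 - a^2 * y^3 * (a * w)"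
      unfolding e1_def e2_def w_def by (simp add: algebra_simps power2_eq_square power3_eq_cube)
    then show ?thesis unfolding aw by (simp add: f_def mult.assoc)
  qed
  \<comment> \<open>The scaling by a^2 q lets \<open>w\<close> occur only as a w = t q, and no power
    of 1/q from \<open>M\<close> survives.\<close>
  define g where "g = a^2 * ((1 - b*c*M) * (1 - b*d*M) * (1 - c*d*M)) * q"
  have "g = a^2 * q - a^2 * (M * q) * e2 + a * (a * w) * M^2 * e1 * q - (a * w)^2 * M^3 * q"
    unfolding g_def e1_def e2_def w_def by (simp add: algebra_simps power2_eq_square power3_eq_cube)
  then have g: "g = a^2 * q - a^2 * N * e2 + a * N^2 * e1 * t - N^3 * t^2"
    unfolding aw N by (simp add: algebra_simps power2_eq_square power3_eq_cube)
  have main: "- J * f N * (1 - t*N*J) - J * (N - J) * g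
    = (1 - t*N^2) * ((1 - a^2*q*J) * (N - J) * (1 - t*N*J) - N * f J)"
    unfolding g f_def by (rule AW_recurrence_polynomial)
  define D where "D = 1 - t * N\<^sup>2"
  have D: "D \<noteq> 0" using nz by (simp add: D_def)
  have "f N / (a * D) * (1 - t*N*J) * (- 1 / N) - g / (a * D) * (1 - J/N)
    = (- J * f N * (1 - t*N*J) - J * (N - J) * g) / (a * D * N * J)"
    using nz D by (simp add: field_simps)
  also have "\<dots> = ((1 - a^2*q*J) * (N - J) * (1 - t*N*J) - N * f J) / (a * N * J)"
    unfolding main D_def[symmetric] using nz D by (simp add: divide_simps)
  also have "\<dots> = (1 - a\<^sup>2*q*J) * (1 - J/N) * (1 - t*N*J) / (a*J) - f J / (a*J)"
    using nz by (simp add: divide_simps)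
  finally show ?thesis
    unfolding f D_def g_def M_def using nz by (simp add: power2_eq_square mult_ac)
qed

text \<open>The recurrence for \<open>P_n\<close> compared at the basis element of index
  \<open>Suc j\<close>, with the factor \<open>aw_kappa\<close> left out. Both products on the left
  and the whole right side are multiples of one expression \<open>E * (1 - q * J)\<close>; what is
  left is \<open>AW_recurrence_rational\<close>.\<close>

lemma aw_e_recurrence:
  fixes a b c d q :: "'a::field"
  assumes nz: "a \<noteq> 0" "q \<noteq> 0" and q: "\<And>k::nat. k \<ge> 1 \<Longrightarrow> q ^ k \<noteq> 1"
    and s: "\<And>k::nat. a * b * c * d * q ^ k \<noteq> 1" and n: "n \<ge> 1"
  defines "e \<equiv> aw_e (a * b * c * d / q) q"
  shows "AW_A a b c d q n * (e (Suc n) (Suc j) - e n (Suc j)) - AW_C a b c d q n * (e n (Suc j) - e (n - 1) (Suc j))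
    = (a * q ^ Suc j + inverse (a * q ^ Suc j) - a - inverse a) * e n (Suc j)
      - (1 - a*b*q^j) * (1 - a*c*q^j) * (1 - a*d*q^j) * inverse (a * q ^ j) * e n j"
proof -
  define t N J where "t = a * b * c * d / q" and "N = q ^ n" and "J = q ^ j"
  have t: "t * q = a * b * c * d" using nz by (simp add: t_def)
  have N: "N \<noteq> 0" and J: "J \<noteq> 0" using nz by (simp_all add: N_def J_def)
  have tq: "t * q ^ Suc k \<noteq> 1" for k
    using s[of k] t by (metis mult.assoc power_Suc)
  have D1: "t * N\<^sup>2 \<noteq> 1"
    using tq[of "2 * n - 1"] n by (simp add: N_def power_even_eq[symmetric])
  have D2: "t * N\<^sup>2 * q \<noteq> 1"
    using tq[of "2 * n"] by (simp add: N_def power_even_eq[symmetric] mult_ac)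
  have D0: "t * N\<^sup>2 / q \<noteq> 1"
  proof -
    have "N\<^sup>2 / q = q * q ^ (2 * n - 2)"
      using n nz by (cases n) (simp_all add: N_def power2_eq_square power_add mult_2_right mult_ac)
    then have "t * N\<^sup>2 / q = t * q * q ^ (2 * n - 2)"
      by (simp only: mult.assoc flip: times_divide_eq_right)
    then show ?thesis unfolding t using s[of "2 * n - 2"] by simp
  qed
  have qJ: "q * J \<noteq> 1" using q[of "Suc j"] by (simp add: J_def)
  obtain n' where n': "n = Suc n'" using n by (cases n) auto
  \<comment> \<open>Common to the coefficients of index \<open>j\<close> and \<open>Suc j\<close>.
    Its denominator runs up to \<open>Suc j\<close>, hence the extra factor 1 - q J in
    \<open>e n j\<close>.\<close>
  define E where "E = qpoch (inverse N) q j * qpoch (t * N) q j * J / qpoch q q (Suc j)"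
  have e0: "e n j = E * (1 - q * J)"
    using qJ by (simp add: e_def aw_e_def E_def qpoch_Suc t_def N_def J_def)
  have e1: "e n (Suc j) = E * q * (1 - J/N) * (1 - t*N*J)"
    by (simp add: e_def aw_e_def E_def qpoch_Suc[of _ _ j] t_def N_def J_def divide_inverse mult_ac)
  have "(1 - t*N) * qpoch (t*N*q) q (Suc j) = qpoch (t*N) q j * (1 - t*N*J) * (1 - t*N*J*q)"
    unfolding qpoch_Suc_shift[symmetric] by (simp add: qpoch_Suc J_def mult_ac)
  moreover have "qpoch (inverse (N*q)) q (Suc j) = (1 - inverse (N*q)) * qpoch (inverse N) q j"
    using nz by (subst qpoch_Suc_shift) (simp add: mult.assoc)
  ultimately have e2: "(1 - t*N) * e (Suc n) (Suc j) = E * q * (1 - inverse (N*q)) * (1 - t*N*J) * (1 - t*N*J*q)"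
    unfolding e_def aw_e_def E_def t_def[symmetric] power_Suc2 N_def[symmetric] J_def[symmetric]
    by (simp add: mult_ac)
  have "(1 - inverse N) * qpoch (inverse N * q) q (Suc j) = qpoch (inverse N) q j * (1 - J/N) * (1 - J*q/N)"
    unfolding qpoch_Suc_shift[symmetric] by (simp add: qpoch_Suc J_def mult_ac divide_inverse)
  moreover have "qpoch (t*N/q) q (Suc j) = (1 - t*N/q) * qpoch (t*N) q j"
    using nz by (subst qpoch_Suc_shift) simp
  moreover have "inverse (q ^ n') = inverse N * q" "t * q ^ n' = t * N / q"
    using nz by (simp_all add: N_def n')
  ultimately have e3: "(1 - inverse N) * e (n - 1) (Suc j) = E * q * (1 - J/N) * (1 - J*q/N) * (1 - t*N/q)"
    unfolding e_def aw_e_def E_def t_def[symmetric] power_Suc2 n' J_def[symmetric] diff_Suc_1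
    by (simp add: mult_ac)
  \<comment> \<open>\<open>AW_A\<close> contains 1 - t N and \<open>AW_C\<close> contains 1 - 1/N,
    exactly the factors that multiply \<open>e (Suc n)\<close> in \<open>e2\<close> and
    \<open>e (n - 1)\<close> in \<open>e3\<close>. They are split off here to be absorbed
    there.\<close>
  define A' C' where "A' = (1 - a*b*N) * (1 - a*c*N) * (1 - a*d*N) / (a * (1 - t*N\<^sup>2) * (1 - t*N\<^sup>2*q))"
    and "C' = - a * N * (1 - b*c*(N/q)) * (1 - b*d*(N/q)) * (1 - c*d*(N/q)) / ((1 - t*N\<^sup>2/q) * (1 - t*N\<^sup>2))"
  have pw: "q ^ (n - 1) = N / q" "q ^ (2 * n - 2) = N\<^sup>2 / q\<^sup>2" "q ^ (2 * n - 1) = N\<^sup>2 / q" "q ^ (2 * n) = N\<^sup>2"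
    using nz by (simp_all add: N_def n' power2_eq_square power_add mult_2)
  have A: "AW_A a b c d q n = (1 - t*N) * A'"
    unfolding AW_A_def A'_def t[symmetric] pw N_def[symmetric] using n nz
    by (simp add: mult_ac)
  have C: "AW_C a b c d q n = (1 - inverse N) * C'"
  proof -
    have eqs: "t * q * (N\<^sup>2 / q\<^sup>2) = t * N\<^sup>2 / q" "t * q * (N\<^sup>2 / q) = t * N\<^sup>2" "1 - N = - ((1 - inverse N) * N)"
      using nz N by (simp_all add: power2_eq_square algebra_simps)
    show ?thesis
      unfolding AW_C_def C'_def t[symmetric] pw N_def[symmetric] eqs using n by (simp add: mult_ac)
  qed
  have "AW_A a b c d q n * (e (Suc n) (Suc j) - e n (Suc j)) =
      A' * ((1 - t*N) * e (Suc n) (Suc j) - (1 - t*N) * e n (Suc j))"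
    unfolding A by (simp add: algebra_simps)
  also have "\<dots> = A' * E * q * (1 - t*N*J) * ((1 - inverse (N*q)) * (1 - t*N*J*q) - (1 - J/N) * (1 - t*N))"
    unfolding e2 e1 by (simp only: algebra_simps)
  \<comment> \<open>This bracket and the corresponding one for \<open>AW_C\<close> split off 1 - q
    J; another factor cancels a denominator of \<open>A'\<close> or \<open>C'\<close>.\<close>
  also have "(1 - inverse (N*q)) * (1 - t*N*J*q) - (1 - J/N) * (1 - t*N) = - (1 - q*J) * (1 - t*N\<^sup>2*q) / (N*q)"
    using nz N by (simp add: field_simps power2_eq_square)
  also have "A' * E * q * (1 - t*N*J) * \<dots> = E * (1 - q*J) *
      ((1 - a*b*N) * (1 - a*c*N) * (1 - a*d*N) / (a * (1 - t*N\<^sup>2)) * (1 - t*N*J) * (- 1 / N))"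
  proof -
    have h: "x / (a * y * z) * E * q * u * (- v * z / (N*q)) = E * v * (x / (a * y) * u * (- 1 / N))"
      if "z \<noteq> 0" for x y z u v using that nz by (simp add: mult_ac)
    show ?thesis unfolding A'_def by (rule h) (use D2 in simp)
  qed
  finally have 1: "AW_A a b c d q n * (e (Suc n) (Suc j) - e n (Suc j)) = \<dots>" .
  have "AW_C a b c d q n * (e n (Suc j) - e (n - 1) (Suc j)) =
      C' * ((1 - inverse N) * e n (Suc j) - (1 - inverse N) * e (n - 1) (Suc j))"
    unfolding C by (simp add: algebra_simps)
  also have "\<dots> = C' * E * q * (1 - J/N) * ((1 - inverse N) * (1 - t*N*J) - (1 - J*q/N) * (1 - t*N/q))"
    unfolding e3 e1 by (simp only: algebra_simps)
  also have "(1 - inverse N) * (1 - t*N*J) - (1 - J*q/N) * (1 - t*N/q) = - (1 - q*J) * (1 - t*N\<^sup>2/q) / N"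
    using nz N by (simp add: field_simps power2_eq_square)
  also have "C' * E * q * (1 - J/N) * \<dots> = E * (1 - q*J) *
      (a * (1 - b*c*(N/q)) * (1 - b*d*(N/q)) * (1 - c*d*(N/q)) / (1 - t*N\<^sup>2) * q * (1 - J/N))"
  proof -
    have h: "- a * N * x * x' * x'' / (z * y) * E * q * u * (- v * z / N) = E * v * (a * x * x' * x'' / y * q * u)"
      if "z \<noteq> 0" for x x' x'' y z u v using that N by (simp add: mult_ac)
    show ?thesis unfolding C'_def by (rule h) (use D0 in simp)
  qed
  finally have 2: "AW_C a b c d q n * (e n (Suc j) - e (n - 1) (Suc j)) = \<dots>" .
  have "a * q ^ Suc j + inverse (a * q ^ Suc j) - a - inverse a = (1 - q*J) * (1 - a\<^sup>2*q*J) / (a*q*J)"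
    using nz J unfolding power_Suc J_def[symmetric] by (simp add: field_simps power2_eq_square)
  then have 3: "(a * q ^ Suc j + inverse (a * q ^ Suc j) - a - inverse a) * e n (Suc j)
      - (1 - a*b*q^j) * (1 - a*c*q^j) * (1 - a*d*q^j) * inverse (a * q ^ j) * e n j
    = E * (1 - q*J) * ((1 - a\<^sup>2*q*J) * (1 - J/N) * (1 - t*N*J) / (a*J)
      - (1 - a*b*J) * (1 - a*c*J) * (1 - a*d*J) / (a*J))"
  proof -
    assume y: "a * q ^ Suc j + inverse (a * q ^ Suc j) - a - inverse a = (1 - q*J) * (1 - a\<^sup>2*q*J) / (a*q*J)"
    have "V * W / (a*q*J) * (E * q * r * r') - F * inverse (a * J) * (E * V) = E * V * (W * r * r' / (a*J) - F / (a*J))"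
      for V W r r' F
    proof -
      have "V * W / (a*q*J) * (E * q * r * r') = E * V * (W * r * r' / (a*J))"
        using nz by (simp add: mult_ac)
      moreover have "F * inverse (a * J) * (E * V) = E * V * (F / (a*J))"
        by (simp add: divide_inverse mult_ac)
      ultimately show ?thesis by (simp only: right_diff_distrib)
    qed
    then show ?thesis unfolding y e0 e1 J_def[symmetric] .
  qed
  show ?thesis
    unfolding 1 2 3 unfolding right_diff_distrib[symmetric]
    by (simp only: AW_recurrence_rational[OF nz N J D1 t])
qed


text \<open>The ratio does not depend on \<open>k\<close>, since each of the three products gains
  its factor with q^n at the top end. So \<open>aw_kappa\<close> can be factored out of the
  recurrence in \<open>n\<close>.\<close>

lemma aw_kappa_Suc:
  fixes a b c d q :: "'a::field_char_0"
  assumes nz: "a \<noteq> 0" "q \<noteq> 0" and s: "\<And>k::nat. a * b * c * d * q ^ k \<noteq> 1" and k: "k \<le> n"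
  shows "aw_kappa a b c d q (Suc n) k = aw_kappa a b c d q n k * AW_A a b c d q n / 2"
proof -
  define t where "t = a * b * c * d / q"
  have t: "t * q = a * b * c * d" using nz by (simp add: t_def)
  have tq: "t * q ^ Suc k \<noteq> 1" for k
    using s[of k] t by (metis mult.assoc power_Suc)
  have num: "qpoch (a * y * q ^ k) q (Suc n - k) = qpoch (a * y * q ^ k) q (n - k) * (1 - a * y * q ^ n)" for y
    using k by (simp add: Suc_diff_le qpoch_Suc mult.assoc flip: power_add)
  show ?thesis
  proof (cases n)
    \<comment> \<open>Separate because \<open>AW_A\<close> at n = 0 has 1 - abcd/q cancelled, a
      factor that may vanish.\<close>
    case 0
    then show ?thesis using nz k
      by (simp add: aw_kappa_def AW_A_def qpoch_Suc)
  next
    case (Suc n')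
    have den0: "qpoch (t * q ^ n) q n \<noteq> 0" "qpoch (t * q ^ Suc n) q (Suc n) \<noteq> 0"
      using tq[of "n' + _"] tq[of "n + _"]
      by (auto intro!: qpoch_nonzero simp: Suc power_add mult_ac)
    have "(1 - t * q ^ n) * qpoch (t * q ^ n * q) q (Suc n) =
        qpoch (t * q ^ n) q n * (1 - t * q ^ (2 * n)) * (1 - t * q ^ (2 * n + 1))"
      unfolding qpoch_Suc_shift[symmetric] by (simp add: qpoch_Suc power_add mult_2 mult_2_right mult_ac)
    then have den: "(1 - t * q ^ n) * qpoch (t * q ^ Suc n) q (Suc n) =
        qpoch (t * q ^ n) q n * ((1 - t * q ^ (2 * n)) * (1 - t * q ^ (2 * n + 1)))"
      by (simp add: mult_ac)
    have A: "AW_A a b c d q n = (1 - a*b * q^n) * (1 - a*c * q^n) * (1 - a*d * q^n) * (1 - t * q^n) /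
          (a * ((1 - t * q ^ (2 * n)) * (1 - t * q ^ (2 * n + 1))))"
      unfolding AW_A_def t[symmetric] by (simp add: Suc mult_ac)
    have nz': "1 - t * q ^ (2 * n) \<noteq> 0" "1 - t * q ^ (2 * n + 1) \<noteq> 0"
      using tq[of "2 * n - 1"] tq[of "2 * n"] by (simp_all add: Suc)
    have "x / ((2*a) ^ Suc n * Q') = (y / ((2*a) ^ n * Q)) * (z * w / (a * D)) / 2"
      if "x = y * z" "w * Q' = Q * D" "Q \<noteq> 0" "Q' \<noteq> 0" "D \<noteq> 0" for x y z w Q Q' D :: 'a
    proof -
      have w: "w = Q * D / Q'" using that by (simp add: field_simps)
      show ?thesis unfolding w that(1) using that nz by simp
    qed
    from this[OF _ den den0 no_zero_divisors[OF nz']]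
    show ?thesis unfolding A aw_kappa_def num t_def[symmetric] by (simp add: mult_ac)
  qed
qed

lemma aw_kappa_Suc_right:
  assumes "k < n"
  shows "aw_kappa a b c d q n k = (1 - a*b*q^k) * (1 - a*c*q^k) * (1 - a*d*q^k) * aw_kappa a b c d q n (Suc k)"
proof -
  have "qpoch (y * q ^ k) q (n - k) = (1 - y * q ^ k) * qpoch (y * q ^ Suc k) q (n - Suc k)" for y
  proof -
    have "n - k = Suc (n - Suc k)" using assms by simp
    then show ?thesis by (simp only: qpoch_Suc_shift) (simp add: mult_ac)
  qed
  from this[of "a*b"] this[of "a*c"] this[of "a*d"]
  show ?thesis by (simp only: aw_kappa_def times_divide_eq_right mult_ac)
qed

definition aw_c :: "'a::field \<Rightarrow> 'a \<Rightarrow> 'a \<Rightarrow> 'a \<Rightarrow> 'a \<Rightarrow> nat \<Rightarrow> nat \<Rightarrow> 'a" where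
  "aw_c a b c d q n k = aw_kappa a b c d q n k * aw_e (a * b * c * d / q) q n k"

lemma aw_c_eq_0: "q \<noteq> 0 \<Longrightarrow> n < k \<Longrightarrow> aw_c a b c d q n k = 0"
  by (simp add: aw_c_def aw_e_eq_0)

text \<open>On the diagonal (t q^n; q)_n cancels between \<open>aw_kappa\<close> and
  \<open>aw_e\<close>. The ratio obtained is inverse to that of the leading coefficients of the
  basis elements, as monic polynomials require. It supplies the case k = n + 1 of the recurrence and
  the nonvanishing of the diagonal.\<close>

lemma aw_c_diagonal_Suc:
  fixes a b c d q :: "'a::field_char_0"
  assumes nz: "a \<noteq> 0" "q \<noteq> 0" and q: "\<And>k::nat. k \<ge> 1 \<Longrightarrow> q ^ k \<noteq> 1"
    and s: "\<And>k::nat. a * b * c * d * q ^ k \<noteq> 1"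
  shows "2 * aw_c a b c d q (Suc n) (Suc n) = - inverse (a * q ^ n) * aw_c a b c d q n n"
proof -
  define t where "t = a * b * c * d / q"
  have diag: "aw_c a b c d q n n = qpoch (inverse (q ^ n)) q n * q ^ n / ((2*a) ^ n * qpoch q q n)" for n
  proof -
    have "qpoch (t * q ^ n) q n \<noteq> 0"
    proof (cases n)
      case (Suc n')
      have "t * q = a * b * c * d" using nz by (simp add: t_def)
      then have "t * q ^ Suc k \<noteq> 1" for k
        using s[of k] by (metis mult.assoc power_Suc)
      from this[of "n' + _"] show ?thesis
        by (auto intro!: qpoch_nonzero simp: Suc power_add mult_ac)
    qed simp
    then show ?thesis unfolding aw_c_def aw_e_def aw_kappa_def t_def[symmetric] by (simp add: mult_ac)
  qed
  have "qpoch (inverse (q ^ Suc n)) q (Suc n) = (1 - inverse (q ^ Suc n)) * qpoch (inverse (q ^ n)) q n"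
  proof -
    have "inverse (q ^ Suc n) * q = inverse (q ^ n)" using nz by simp
    then show ?thesis by (simp only: qpoch_Suc_shift)
  qed
  moreover have "1 - inverse (q ^ Suc n) = - inverse (q ^ Suc n) * (1 - q * q ^ n)" "1 - q * q ^ n \<noteq> 0"
    using nz q[of "Suc n"] by (simp_all add: field_simps)
  moreover have main: "2 * (- inverse (q * z) * v * X * (q * z) / (2 * a * P * (Y * v))) = - inverse (a * z) * (X * z / (P * Y))"
    if "z \<noteq> 0" "v \<noteq> 0" for z v X P Y
    using that nz by (simp add: field_simps)
  ultimately show ?thesis
    unfolding diag qpoch_Suc[of q q n] power_Suc using nz
    by (simp only:) (rule main, simp_all)
qed

text \<open>The three-term recurrence of \<open>P_n\<close>, with \<open>x_mult_aw_phi\<close>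
  applied, read off at index \<open>k\<close>. For 1 \<le> k \<le> n it reduces to
  \<open>aw_e_recurrence\<close>; at k = n + 1 only diagonal entries survive, and beyond that all
  terms are 0.\<close>

lemma aw_c_recurrence:
  fixes a b c d q :: "'a::field_char_0"
  assumes nz: "a \<noteq> 0" "q \<noteq> 0" and q: "\<And>k::nat. k \<ge> 1 \<Longrightarrow> q ^ k \<noteq> 1"
    and s: "\<And>k::nat. a * b * c * d * q ^ k \<noteq> 1" and n: "n \<ge> 1"
  defines "C \<equiv> aw_c a b c d q"
  shows "2 * C (Suc n) k =
    (a * q ^ k + inverse (a * q ^ k)) * C n k
      - (if k = 0 then 0 else inverse (a * q ^ (k - 1)) * C n (k - 1))
      - 2 * AW_b a b c d q n * C n k - 2 * AW_lambda a b c d q n * C (n - 1) k"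
proof (cases "k \<le> n")
  case False
  show ?thesis
  proof (cases "k = Suc n")
    case True
    then show ?thesis
      using aw_c_diagonal_Suc[OF nz q s, of n] nz by (simp add: C_def aw_c_eq_0)
  next
    case False
    with \<open>\<not> k \<le> n\<close> have "Suc n < k" "n < k - 1" "n - 1 < k" by auto
    then show ?thesis using nz by (simp add: C_def aw_c_eq_0)
  qed
next
  case k: True
  define e K where "e = aw_e (a * b * c * d / q) q" and "K = aw_kappa a b c d q n k"
  define A B where "A = AW_A a b c d q n" and "B = AW_C a b c d q n"
  have C1: "2 * C (Suc n) k = K * A * e (Suc n) k"
    unfolding C_def aw_c_def e_def K_def A_def aw_kappa_Suc[OF nz s k] by simp
  have C0: "C n k = K * e n k"
    by (simp add: C_def aw_c_def e_def K_def)
  have Cl: "2 * AW_lambda a b c d q n * C (n - 1) k = K * B * e (n - 1) k"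
  \<comment> \<open>At k = n both sides are 0; otherwise k \<le> n - 1, as
    \<open>aw_kappa_Suc\<close> requires.\<close>
  proof (cases "k = n")
    case True
    then show ?thesis using n nz by (simp add: C_def aw_c_eq_0 e_def aw_e_eq_0)
  next
    case False
    with k n have "k \<le> n - 1" "Suc (n - 1) = n" by auto
    then have "K = aw_kappa a b c d q (n - 1) k * AW_A a b c d q (n - 1) / 2"
      using aw_kappa_Suc[OF nz s, of k "n - 1"] by (simp add: K_def)
    then show ?thesis by (simp add: C_def aw_c_def e_def B_def AW_lambda_def)
  qed
  have b: "2 * AW_b a b c d q n = a + inverse a - (A + B)"
    by (simp add: AW_b_def A_def B_def)
  show ?thesis
  proof (cases k)
    case 0
    \<comment> \<open>With all \<open>e\<close> equal to 1 the equation is just the definition of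
      \<open>AW_b\<close>.\<close>
    have "e m 0 = 1" for m by (simp add: e_def)
    then show ?thesis unfolding C1 Cl b C0 by (simp add: 0 algebra_simps)
  next
    case (Suc j)
    have Cj: "C n j = (1 - a*b*q^j) * (1 - a*c*q^j) * (1 - a*d*q^j) * K * e n j"
      using k Suc aw_kappa_Suc_right[of j n a b c d q] by (simp add: C_def aw_c_def e_def K_def)
    have "A * (e (Suc n) k - e n k) - B * (e n k - e (n - 1) k)
      = (a * q ^ k + inverse (a * q ^ k) - a - inverse a) * e n k
      - (1 - a*b*q^j) * (1 - a*c*q^j) * (1 - a*d*q^j) * inverse (a * q ^ j) * e n j"
      unfolding A_def B_def e_def Suc by (rule aw_e_recurrence[OF nz q s n])
    then have "K * (A * (e (Suc n) k - e n k) - B * (e n k - e (n - 1) k))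
      = K * ((a * q ^ k + inverse (a * q ^ k) - a - inverse a) * e n k
      - (1 - a*b*q^j) * (1 - a*c*q^j) * (1 - a*d*q^j) * inverse (a * q ^ j) * e n j)"
      by simp
    moreover have "K * A * x = y * (K * x') - i * (F * K * z) - (a + a' - (A + B)) * (K * x') - K * B * x''"
      if "K * (A * (x - x') - B * (x' - x'')) = K * ((y - a - a') * x' - F * i * z)" for x x' x'' y i F z a'
      using that by algebra
    ultimately show ?thesis unfolding C1 Cl b C0 using Suc by (simp add: Cj)
  qed
qed

lemma AW_poly_expansion:
  fixes a b c d q :: "'a::field_char_0"
  assumes nz: "a \<noteq> 0" "q \<noteq> 0" and q: "\<And>k::nat. k \<ge> 1 \<Longrightarrow> q ^ k \<noteq> 1"
    and s: "\<And>k::nat. a * b * c * d * q ^ k \<noteq> 1"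
  shows "AW_poly a b c d q n = (\<Sum>k\<le>n. smult (aw_c a b c d q n k) (aw_phi a q k))"
proof -
  let ?C = "aw_c a b c d q" and ?phi = "\<lambda>k. poly (aw_phi a q k)"
  have "poly (AW_poly a b c d q n) x = (\<Sum>k\<le>n. ?C n k * ?phi k x)" for x
  proof (induction n rule: induct_nat_012)
    case 0
    show ?case by (simp add: aw_c_def aw_kappa_def)
  next
    case 1
    have c0: "?C 1 0 = AW_A a b c d q 0 / 2"
      using aw_kappa_Suc[OF nz s, of 0 0] by (simp add: aw_c_def aw_kappa_def)
    have "?C 0 0 = 1" by (simp add: aw_c_def aw_kappa_def)
    then have c1: "?C 1 1 = - inverse a / 2"
      using aw_c_diagonal_Suc[OF nz q s, of 0] by (intro eq_divide_imp) (simp_all add: mult.commute)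
    show ?case using c0 c1 nz
      by (simp add: AW_b_def AW_C_def aw_phi_def field_simps power2_eq_square)
  next
    case (ge2 n)
    let ?n = "Suc n"
    \<comment> \<open>All sums are brought to the common range k \<le> n + 2, where the added
      coefficients are 0. The same vanishing removes the boundary term of the index shift that
      follows.\<close>
    have ext: "(\<Sum>k\<le>m. ?C m k * ?phi k x) = (\<Sum>k\<le>Suc ?n. ?C m k * ?phi k x)" if "m \<le> Suc ?n" for m
      using that nz by (intro sum.mono_neutral_left) (auto simp: aw_c_eq_0)
    have shift: "(\<Sum>k\<le>Suc ?n. (if k = 0 then 0 else inverse (a * q ^ (k - 1)) * ?C ?n (k - 1)) * ?phi k x)
      = (\<Sum>k\<le>Suc ?n. inverse (a * q ^ k) * ?C ?n k * ?phi (Suc k) x)"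
      by (subst sum.atMost_Suc_shift) (simp add: aw_c_eq_0 nz)
    have "2 * poly (AW_poly a b c d q (Suc ?n)) x
      = 2 * (x - AW_b a b c d q ?n) * (\<Sum>k\<le>Suc ?n. ?C ?n k * ?phi k x)
        - 2 * AW_lambda a b c d q ?n * (\<Sum>k\<le>Suc ?n. ?C n k * ?phi k x)"
      using ge2 ext[of n] ext[of ?n] by (simp add: algebra_simps del: sum.atMost_Suc)
    also have "2 * (x - AW_b a b c d q ?n) * (\<Sum>k\<le>Suc ?n. ?C ?n k * ?phi k x)
      = (\<Sum>k\<le>Suc ?n. ?C ?n k * (2 * x * ?phi k x)) - (\<Sum>k\<le>Suc ?n. 2 * AW_b a b c d q ?n * ?C ?n k * ?phi k x)"
      unfolding sum_subtractf[symmetric] sum_distrib_left by (intro sum.cong) (simp_all add: algebra_simps)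
    also have "(\<Sum>k\<le>Suc ?n. ?C ?n k * (2 * x * ?phi k x))
      = (\<Sum>k\<le>Suc ?n. (a * q ^ k + inverse (a * q ^ k)) * ?C ?n k * ?phi k x)
        - (\<Sum>k\<le>Suc ?n. inverse (a * q ^ k) * ?C ?n k * ?phi (Suc k) x)"
      unfolding sum_subtractf[symmetric] x_mult_aw_phi[OF nz]
      by (intro sum.cong) (simp_all add: algebra_simps)
    also have "\<dots> - (\<Sum>k\<le>Suc ?n. 2 * AW_b a b c d q ?n * ?C ?n k * ?phi k x)
        - 2 * AW_lambda a b c d q ?n * (\<Sum>k\<le>Suc ?n. ?C n k * ?phi k x)
      = (\<Sum>k\<le>Suc ?n. 2 * ?C (Suc ?n) k * ?phi k x)"
      unfolding shift[symmetric] sum_subtractf[symmetric] sum_distrib_left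
      by (intro sum.cong refl, subst aw_c_recurrence[OF nz q s])
        (simp_all add: algebra_simps)
    finally have "2 * poly (AW_poly a b c d q (Suc ?n)) x = 2 * (\<Sum>k\<le>Suc ?n. ?C (Suc ?n) k * ?phi k x)"
      unfolding sum_distrib_left by (simp only: mult.assoc)
    then show ?case by (simp del: sum.atMost_Suc AW_poly.simps)
  qed
  then show ?thesis
    unfolding poly_eq_poly_eq_iff[symmetric] fun_eq_iff by (simp add: poly_sum)
qed

section \<open>Values of the functional on the basis\<close>

text \<open>With z = q^j the induction step is (1 - qz)(1 - ABqz) + (1 - A)(1 - B)qz = (1 - Aqz)(1 -
  Bqz), which holds because the lower parameter is ABq.\<close>

lemma qpoch_sum_telescope:
  fixes A B q :: "'a::field"
  assumes q: "\<And>k::nat. k \<ge> 1 \<Longrightarrow> q ^ k \<noteq> 1" and C: "\<And>k. A * B * q * q ^ k \<noteq> 1"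
  shows "(\<Sum>k\<le>j. qpoch A q k * qpoch B q k * q ^ k / (qpoch q q k * qpoch (A * B * q) q k))
    = qpoch (A * q) q j * qpoch (B * q) q j / (qpoch q q j * qpoch (A * B * q) q j)"
proof (induction j)
  case (Suc j)
  define u v w y where "u = qpoch (A * q) q j" and "v = qpoch (B * q) q j"
    and "w = qpoch q q j" and "y = qpoch (A * B * q) q j"
  define z where "z = q ^ j"
  have nz: "w \<noteq> 0" "y \<noteq> 0" "1 - q * z \<noteq> 0" "1 - A * B * q * z \<noteq> 0"
    using qpoch_self_nonzero[OF q] C q[of "Suc j"] by (auto simp: w_def y_def z_def qpoch_nonzero)
  have "qpoch A q (Suc j) * qpoch B q (Suc j) = (1 - A) * (1 - B) * u * v"
    by (simp add: qpoch_Suc_shift u_def v_def)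
  moreover have "u * v / (w * y) + (1 - A) * (1 - B) * u * v * (q * z) / (w * (1 - q * z) * (y * (1 - A * B * q * z)))
    = (u * (1 - A * q * z)) * (v * (1 - B * q * z)) / (w * (1 - q * z) * (y * (1 - A * B * q * z)))"
  proof -
    have "u * v / (w * y) = u * v * ((1 - q * z) * (1 - A * B * q * z)) / (w * (1 - q * z) * (y * (1 - A * B * q * z)))"
      using nz by simp
    moreover have "u * v * ((1 - q * z) * (1 - A * B * q * z)) + (1 - A) * (1 - B) * u * v * (q * z)
      = (u * (1 - A * q * z)) * (v * (1 - B * q * z))"
      by algebra
    ultimately show ?thesis by (metis add_divide_distrib)
  qed
  ultimately show ?case
    by (simp add: Suc qpoch_Suc u_def v_def w_def y_def z_def)
qed simp

text \<open>Applying \<open>L\<close> to the expansion of \<open>P_m\<close> gives a linear relation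
  between its values on the basis elements up to index \<open>m\<close>. The claimed values satisfy
  the same relation, and the last coefficient is nonzero, so strong induction determines the value
  at \<open>m\<close>.\<close>

lemma AW_functional_phi:
  fixes a b c d q :: "'a::field_char_0"
  assumes nz: "a \<noteq> 0" "q \<noteq> 0" and q: "\<And>k::nat. k \<ge> 1 \<Longrightarrow> q ^ k \<noteq> 1"
    and s: "\<And>k::nat. a * b * c * d * q ^ k \<noteq> 1"
    and L: "is_AW_functional a b c d q L"
  shows "L (aw_phi a q m) = qpoch (a*b) q m * qpoch (a*c) q m * qpoch (a*d) q m / qpoch (a*b*c*d) q m"
proof (induction m rule: less_induct)
  case (less m)
  define G where "G = (\<lambda>m. qpoch (a*b) q m * qpoch (a*c) q m * qpoch (a*d) q m / qpoch (a*b*c*d) q m)"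
  define t where "t = a * b * c * d / q"
  let ?C = "aw_c a b c d q m"
  have lin: "L (p + r) = L p + L r" "L (smult x p) = x * L p" for p r x
    using L unfolding is_AW_functional_def linear_smult_iff by auto
  have L0: "L 0 = 0" using lin(2)[of 0 0] by simp
  have Lsum: "L (sum f S) = (\<Sum>x\<in>S. L (f x))" if "finite S" for f and S :: "nat set"
    using that by (induction S rule: finite_induct) (simp_all add: L0 lin)
  show ?case
  proof (cases "m = 0")
    case True
    then show ?thesis using L by (simp add: is_AW_functional_def)
  next
    case False
    have "0 = L (AW_poly a b c d q m)"
      using L False by (simp add: is_AW_functional_def)
    also have "\<dots> = (\<Sum>k\<le>m. ?C k * L (aw_phi a q k))"
      by (simp add: AW_poly_expansion[OF nz q s] Lsum lin)
    finally have 1: "(\<Sum>k<m. ?C k * L (aw_phi a q k)) + ?C m * L (aw_phi a q m) = 0"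
      by (simp flip: lessThan_Suc_atMost)
    \<comment> \<open>The products up to \<open>k\<close> in \<open>G\<close> complete those from
      \<open>k\<close> to \<open>m\<close> in \<open>aw_kappa\<close>. The remaining dependence on
      \<open>k\<close> is the summand of \<open>qpoch_sum_telescope\<close> with A = q^(-m), B = t
      q^m and ABq = abcd.\<close>
    have "?C k * G k = qpoch (a*b) q m * qpoch (a*c) q m * qpoch (a*d) q m / ((2 * a) ^ m * qpoch (t * q ^ m) q m) *
        (qpoch (inverse (q ^ m)) q k * qpoch (t * q ^ m) q k * q ^ k /
         (qpoch q q k * qpoch (inverse (q ^ m) * (t * q ^ m) * q) q k))" if "k \<le> m" for k
    proof -
      have "qpoch y q m = qpoch y q k * qpoch (y * q ^ k) q (m - k)" for y
        using qpoch_add[of y q k "m - k"] that by simp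
      moreover have "inverse (q ^ m) * (t * q ^ m) * q = a * b * c * d"
        using nz by (simp add: t_def)
      ultimately show ?thesis
        unfolding aw_c_def aw_kappa_def aw_e_def G_def t_def[symmetric] by (simp add: mult_ac)
    qed
    then have "(\<Sum>k\<le>m. ?C k * G k) = qpoch (a*b) q m * qpoch (a*c) q m * qpoch (a*d) q m / ((2 * a) ^ m * qpoch (t * q ^ m) q m) *
        (\<Sum>k\<le>m. qpoch (inverse (q ^ m)) q k * qpoch (t * q ^ m) q k * q ^ k /
         (qpoch q q k * qpoch (inverse (q ^ m) * (t * q ^ m) * q) q k))"
      by (simp add: sum_distrib_left)
    also have "\<dots> = 0"
    proof -
      have "inverse (q ^ m) * (t * q ^ m) * q = a * b * c * d"
        using nz by (simp add: t_def)
      then have "inverse (q ^ m) * (t * q ^ m) * q * q ^ k \<noteq> 1" for k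
        using s[of k] by simp
      \<comment> \<open>The closed form of the sum contains (q^(1-m); q)_m, which has a zero factor
        as m \<ge> 1.\<close>
      moreover have "qpoch (inverse (q ^ m) * q) q m = 0"
      proof -
        have "inverse (q ^ m) * q = inverse (q ^ (m - 1))"
          using False nz by (cases m) auto
        then show ?thesis
          using False nz by (simp add: qpoch_inverse_power_eq_0)
      qed
      ultimately show ?thesis
        by (subst qpoch_sum_telescope) (use q in auto)
    qed
    finally have 2: "(\<Sum>k<m. ?C k * G k) + ?C m * G m = 0"
      by (simp flip: lessThan_Suc_atMost)
    have "(\<Sum>k<m. ?C k * L (aw_phi a q k)) = (\<Sum>k<m. ?C k * G k)"
      using less by (simp add: G_def)
    with 1 2 have "?C m * L (aw_phi a q m) = ?C m * G m"
      by (metis add_left_imp_eq)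
    moreover have "?C n \<noteq> 0" if "n = m" for n
    proof -
      have "aw_c a b c d q n n \<noteq> 0" for n
      proof (induction n)
        case 0
        show ?case by (simp add: aw_c_def aw_kappa_def)
      next
        case (Suc n)
        then show ?case using aw_c_diagonal_Suc[OF nz q s, of n] nz
          by (metis inverse_nonzero_iff_nonzero mult_eq_0_iff neg_equal_0_iff_equal power_not_zero)
      qed
      then show ?thesis using that by simp
    qed
    ultimately have "L (aw_phi a q m) = G m" by simp
    then show ?thesis by (simp add: G_def)
  qed
qed

section \<open>\<open>q\<close>-binomial series and the generating functions of the Chebyshev
  coefficients\<close>

lemma qbinom_add: "qbinom q (m + p) m = qpoch q q (m + p) / (qpoch q q m * qpoch q q p)"
  by (simp add: qbinom_def)

text \<open>With x = q^(m+1) and y = q^(p+1) the two rules come from splitting 1 - xy as (1 - x) +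
  x(1 - y) or as y(1 - x) + (1 - y).\<close>

lemma qbinom_Pascal:
  fixes q :: "'a::field"
  assumes q: "\<And>k::nat. k \<ge> 1 \<Longrightarrow> q ^ k \<noteq> 1"
  shows "qbinom q (Suc m + Suc p) (Suc m) = qbinom q (m + Suc p) m + q ^ Suc m * qbinom q (Suc m + p) (Suc m)" (is ?A)
    and "qbinom q (Suc m + Suc p) (Suc m) = q ^ Suc p * qbinom q (m + Suc p) m + qbinom q (Suc m + p) (Suc m)" (is ?B)
proof -
  define W x y X Y where "W = qpoch q q (Suc (m + p))" and "x = q * q ^ m" and "y = q * q ^ p"
    and "X = qpoch q q m" and "Y = qpoch q q p"
  have nz: "X \<noteq> 0" "Y \<noteq> 0" "1 - x \<noteq> 0" "1 - y \<noteq> 0"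
    using qpoch_self_nonzero[OF q] q[of "Suc m"] q[of "Suc p"] by (simp_all add: X_def Y_def x_def y_def)
  have 1: "qbinom q (Suc m + Suc p) (Suc m) = W * (1 - x * y) / (X * (1 - x) * (Y * (1 - y)))"
  proof -
    have "qpoch q q (Suc m + Suc p) = W * (1 - x * y)"
      by (simp add: W_def x_def y_def qpoch_Suc[of _ _ "Suc (m + p)"] power_add mult_ac)
    then show ?thesis
      unfolding qbinom_add by (simp add: X_def Y_def x_def y_def qpoch_Suc)
  qed
  have 2: "qbinom q (m + Suc p) m = W / (X * (Y * (1 - y)))"
    unfolding qbinom_add by (simp add: W_def X_def Y_def y_def qpoch_Suc)
  have 3: "qbinom q (Suc m + p) (Suc m) = W / (X * (1 - x) * Y)"
    unfolding qbinom_add by (simp add: W_def X_def Y_def x_def qpoch_Suc)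
  have n2: "W / (X * (Y * (1 - y))) = W * (1 - x) / (X * (1 - x) * (Y * (1 - y)))"
    and n3: "W / (X * (1 - x) * Y) = W * (1 - y) / (X * (1 - x) * (Y * (1 - y)))"
    using nz by simp_all
  show ?A ?B
    unfolding 1 2 3 n2 n3 power_Suc x_def[symmetric] y_def[symmetric]
      times_divide_eq_right add_divide_distrib[symmetric]
    by (simp_all add: algebra_simps)
qed

text \<open>For \<open>q\<close> not a root of unity this is 1 / ((1 - zt)(1 - zqt)...(1 - z q^m t))
  as a series in t, by the \<open>q\<close>-binomial theorem.\<close>

definition qbinom_fps :: "'a::field \<Rightarrow> nat \<Rightarrow> 'a \<Rightarrow> 'a fps" where
  "qbinom_fps q m z = Abs_fps (\<lambda>p. qbinom q (m + p) m * z ^ p)"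

lemma qbinom_self:
  fixes q :: "'a::field"
  assumes "\<And>k::nat. k \<ge> 1 \<Longrightarrow> q ^ k \<noteq> 1"
  shows "qbinom q m m = 1" "qbinom q m 0 = 1"
  using qpoch_self_nonzero[OF assms] by (simp_all add: qbinom_def)

lemma qbinom_fps_0:
  assumes q: "\<And>k::nat. k \<ge> 1 \<Longrightarrow> q ^ k \<noteq> 1"
  shows "(1 - fps_const z * fps_X) * qbinom_fps q 0 z = 1"
proof (rule fps_ext)
  show "((1 - fps_const z * fps_X) * qbinom_fps q 0 z) $ n = 1 $ n" for n
    by (cases n) (simp_all add: qbinom_fps_def qbinom_self[OF q] left_diff_distrib mult.assoc)
qed

text \<open>The first \<open>q\<close>-Pascal rule strips the last factor of the denominator
  product; the second strips the first factor and so shifts z to zq.\<close>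

lemma qbinom_fps_Suc:
  assumes q: "\<And>k::nat. k \<ge> 1 \<Longrightarrow> q ^ k \<noteq> 1"
  shows "(1 - fps_const (z * q ^ Suc m) * fps_X) * qbinom_fps q (Suc m) z = qbinom_fps q m z" (is ?A)
    and "(1 - fps_const z * fps_X) * qbinom_fps q (Suc m) z = qbinom_fps q m (z * q)" (is ?B)
proof -
  show ?A
  proof (rule fps_ext)
    show "((1 - fps_const (z * q ^ Suc m) * fps_X) * qbinom_fps q (Suc m) z) $ n = qbinom_fps q m z $ n" for n
      using qbinom_Pascal(1)[OF q, of m "n - 1"]
      by (cases n) (simp_all add: qbinom_fps_def qbinom_self[OF q] left_diff_distrib mult.assoc algebra_simps)
  qed
  show ?B
  proof (rule fps_ext)
    show "((1 - fps_const z * fps_X) * qbinom_fps q (Suc m) z) $ n = qbinom_fps q m (z * q) $ n" for n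
      using qbinom_Pascal(2)[OF q, of m "n - 1"]
      by (cases n) (simp_all add: qbinom_fps_def qbinom_self[OF q] left_diff_distrib mult.assoc algebra_simps
          power_mult_distrib)
  qed
qed

text \<open>The coefficient of \<open>t\<^sup>N\<close> in \<open>cheb_fps a q m\<close> is the coefficient of \<open>\<phi>\<^sub>m\<close> in \<open>U\<^sub>N\<close>.\<close>

definition cheb_fps :: "'a::field \<Rightarrow> 'a \<Rightarrow> nat \<Rightarrow> 'a fps" where
  "cheb_fps a q m = fps_const (\<Prod>i<m. - inverse (a * q ^ i)) *
     (fps_X ^ m * (qbinom_fps q m a * qbinom_fps q m (inverse (a * q ^ m))))"

lemma cheb_fps_factor:
  fixes y y' :: "'a::field"
  assumes "y * y' = 1"
  shows "1 - fps_const (y + y') * fps_X + fps_X\<^sup>2 = (1 - fps_const y * fps_X) * (1 - fps_const y' * fps_X)"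
proof -
  have "fps_const y * fps_const y' = 1" using assms by simp
  then show ?thesis unfolding fps_const_add[symmetric] by algebra
qed

lemma cheb_fps_0:
  assumes nz: "a \<noteq> 0" and q: "\<And>k::nat. k \<ge> 1 \<Longrightarrow> q ^ k \<noteq> 1"
  shows "(1 - fps_const (a + inverse a) * fps_X + fps_X\<^sup>2) * cheb_fps a q 0 = 1"
proof -
  have f: "1 - fps_const (a + inverse a) * fps_X + fps_X\<^sup>2 =
      (1 - fps_const a * fps_X) * (1 - fps_const (inverse a) * fps_X)"
    using nz by (intro cheb_fps_factor) simp
  have g: "cheb_fps a q 0 = qbinom_fps q 0 a * qbinom_fps q 0 (inverse a)"
    by (simp add: cheb_fps_def)
  have "(1 - fps_const (a + inverse a) * fps_X + fps_X\<^sup>2) * cheb_fps a q 0 =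
    ((1 - fps_const a * fps_X) * qbinom_fps q 0 a) * ((1 - fps_const (inverse a) * fps_X) * qbinom_fps q 0 (inverse a))"
    unfolding f g by (simp only: mult_ac)
  then show ?thesis by (simp only: qbinom_fps_0[OF q] mult_1_left)
qed

text \<open>The quadratic is (1 - yt)(1 - t/y) with y = a q^(m+1). Here 1 - yt is the last factor of
  the product starting at a, while 1 - t/y is the first factor of the product starting at 1/y; hence
  both rules of \<open>qbinom_fps_Suc\<close> are used.\<close>

lemma cheb_fps_Suc:
  assumes nz: "a \<noteq> 0" "q \<noteq> 0" and q: "\<And>k::nat. k \<ge> 1 \<Longrightarrow> q ^ k \<noteq> 1"
  shows "(1 - fps_const (a * q ^ Suc m + inverse (a * q ^ Suc m)) * fps_X + fps_X\<^sup>2) * cheb_fps a q (Suc m)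
    = fps_const (- inverse (a * q ^ m)) * (fps_X * cheb_fps a q m)"
proof -
  define k where "k = (\<Prod>i<m. - inverse (a * q ^ i))"
  define y where "y = a * q ^ Suc m"
  have f: "1 - fps_const (y + inverse y) * fps_X + fps_X\<^sup>2 =
      (1 - fps_const y * fps_X) * (1 - fps_const (inverse y) * fps_X)"
  proof (rule cheb_fps_factor)
    have "y \<noteq> 0" using nz by (simp add: y_def)
    then show "y * inverse y = 1" by (rule right_inverse)
  qed
  have k: "(\<Prod>i<Suc m. - inverse (a * q ^ i)) = k * - inverse (a * q ^ m)"
    unfolding k_def by (rule prod.lessThan_Suc)
  have "(1 - fps_const (y + inverse y) * fps_X + fps_X\<^sup>2) * cheb_fps a q (Suc m)
    = fps_const (- inverse (a * q ^ m)) * (fps_X * (fps_const k * (fps_X ^ m *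
        (((1 - fps_const y * fps_X) * qbinom_fps q (Suc m) a) *
         ((1 - fps_const (inverse y) * fps_X) * qbinom_fps q (Suc m) (inverse y))))))"
    unfolding f cheb_fps_def k y_def[symmetric] fps_const_mult[symmetric] unfolding power_Suc by (simp only: mult_ac)
  also have "(1 - fps_const y * fps_X) * qbinom_fps q (Suc m) a = qbinom_fps q m a"
    unfolding y_def by (rule qbinom_fps_Suc(1)[OF q])
  also have "(1 - fps_const (inverse y) * fps_X) * qbinom_fps q (Suc m) (inverse y) = qbinom_fps q m (inverse (a * q ^ m))"
  proof -
    have "inverse y * q = inverse (a * q ^ m)" using nz by (simp add: y_def)
    with qbinom_fps_Suc(2)[OF q, where m = m and z = "inverse y"] show ?thesis by (simp only:)
  qed
  finally show ?thesis by (simp only: y_def k_def cheb_fps_def)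
qed

lemma cheb_fps_eq_0: "N < m \<Longrightarrow> cheb_fps a q m $ N = 0"
  by (simp add: cheb_fps_def fps_X_power_mult_nth)

text \<open>The coefficient of t^(N+2) in the two preceding identities. It is the Chebyshev
  recurrence U_(N+2) + U_N = 2x U_(N+1) read off at the basis element of index
  \<open>m\<close>.\<close>

lemma cheb_fps_recurrence:
  assumes nz: "a \<noteq> 0" "q \<noteq> 0" and q: "\<And>k::nat. k \<ge> 1 \<Longrightarrow> q ^ k \<noteq> 1"
  shows "cheb_fps a q m $ Suc (Suc N) + cheb_fps a q m $ N
    = (a * q ^ m + inverse (a * q ^ m)) * cheb_fps a q m $ Suc N
      - (if m = 0 then 0 else inverse (a * q ^ (m - 1)) * cheb_fps a q (m - 1) $ Suc N)"
proof -
  have nth: "((1 - fps_const y * fps_X + fps_X\<^sup>2) * f) $ Suc (Suc N) = f $ Suc (Suc N) - y * f $ Suc N + f $ N"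
    for y and f :: "'a fps"
    by (simp add: distrib_right left_diff_distrib mult.assoc fps_X_power_mult_nth)
  show ?thesis
  proof (cases m)
    case 0
    have "((1 - fps_const (a + inverse a) * fps_X + fps_X\<^sup>2) * cheb_fps a q 0) $ Suc (Suc N) = 0"
      by (simp only: cheb_fps_0[OF nz(1) q]) simp
    then show ?thesis unfolding nth 0 by (simp add: algebra_simps)
  next
    case (Suc k)
    have "((1 - fps_const (a * q ^ m + inverse (a * q ^ m)) * fps_X + fps_X\<^sup>2) * cheb_fps a q m) $ Suc (Suc N)
      = - inverse (a * q ^ k) * cheb_fps a q k $ Suc N"
      by (simp only: Suc cheb_fps_Suc[OF nz q]) simp
    then have "cheb_fps a q m $ Suc (Suc N) - (a * q ^ m + inverse (a * q ^ m)) * cheb_fps a q m $ Suc N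
      + cheb_fps a q m $ N = - inverse (a * q ^ k) * cheb_fps a q k $ Suc N"
      unfolding nth .
    moreover have "u + w = v - z" if "u - v + w = - z" for u v w z :: 'a
      using that by (simp add: algebra_simps)
    ultimately show ?thesis using Suc by simp
  qed
qed

section \<open>Chebyshev polynomials in the basis \<open>aw_phi\<close>\<close>

text \<open>The Chebyshev polynomial of the second kind U_N. That \<open>a\<close> and
  \<open>q\<close> affect only its representation follows from the recurrence below.\<close>

definition cheb_poly :: "'a::field \<Rightarrow> 'a \<Rightarrow> nat \<Rightarrow> 'a poly" where
  "cheb_poly a q N = (\<Sum>m\<le>N. smult (cheb_fps a q m $ N) (aw_phi a q m))"

lemma cheb_poly_extend:
  assumes "N \<le> M"
  shows "cheb_poly a q N = (\<Sum>m\<le>M. smult (cheb_fps a q m $ N) (aw_phi a q m))"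
  unfolding cheb_poly_def using assms by (intro sum.mono_neutral_left) (auto simp: cheb_fps_eq_0)

lemma cheb_poly_recurrence:
  fixes a q :: "'a::field_char_0"
  assumes nz: "a \<noteq> 0" "q \<noteq> 0" and q: "\<And>k::nat. k \<ge> 1 \<Longrightarrow> q ^ k \<noteq> 1"
  shows "poly (cheb_poly a q 0) x = 1" "poly (cheb_poly a q (Suc 0)) x = 2 * x"
    "poly (cheb_poly a q (Suc (Suc N))) x + poly (cheb_poly a q N) x = 2 * x * poly (cheb_poly a q (Suc N)) x"
proof -
  show "poly (cheb_poly a q 0) x = 1"
    by (simp add: cheb_poly_def cheb_fps_def qbinom_fps_def qbinom_self[OF q])
  have "cheb_fps a q 0 $ Suc 0 = a + inverse a"
    by (simp add: cheb_fps_def qbinom_fps_def fps_mult_nth qbinom_self[OF q] add.commute)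
  moreover have "cheb_fps a q (Suc 0) $ Suc 0 = - inverse a"
    by (simp add: cheb_fps_def qbinom_fps_def fps_mult_nth qbinom_self[OF q])
  ultimately have "poly (cheb_poly a q (Suc 0)) x = (a + inverse a) - inverse a * poly (aw_phi a q (Suc 0)) x"
    by (simp add: cheb_poly_def)
  also have "\<dots> = 2 * x"
    using x_mult_aw_phi[OF nz, of x 0] by simp
  finally show "poly (cheb_poly a q (Suc 0)) x = 2 * x" .
  let ?phi = "\<lambda>m. poly (aw_phi a q m) x" and ?F = "\<lambda>m. fps_nth (cheb_fps a q m)"
  let ?M = "Suc (Suc N)"
  have ev: "poly (cheb_poly a q K) x = (\<Sum>m\<le>?M. ?F m K * ?phi m)" if "K \<le> ?M" for K
    using that by (simp add: cheb_poly_extend[of K ?M] poly_sum del: sum.atMost_Suc)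
  have shift: "(\<Sum>m\<le>?M. (if m = 0 then 0 else inverse (a * q ^ (m - 1)) * ?F (m - 1) (Suc N)) * ?phi m)
      = (\<Sum>m\<le>?M. inverse (a * q ^ m) * ?F m (Suc N) * ?phi (Suc m))"
    by (subst sum.atMost_Suc_shift) (simp add: cheb_fps_eq_0)
  have "2 * x * poly (cheb_poly a q (Suc N)) x = (\<Sum>m\<le>?M. ?F m (Suc N) * (2 * x * ?phi m))"
  proof -
    have "Suc N \<le> ?M" by simp
    then show ?thesis by (simp only: ev sum_distrib_left mult_ac)
  qed
  also have "\<dots> = (\<Sum>m\<le>?M. (a * q ^ m + inverse (a * q ^ m)) * ?F m (Suc N) * ?phi m)
        - (\<Sum>m\<le>?M. inverse (a * q ^ m) * ?F m (Suc N) * ?phi (Suc m))"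
    unfolding sum_subtractf[symmetric] x_mult_aw_phi[OF nz]
    by (intro sum.cong) (simp_all only: algebra_simps)
  also have "\<dots> = (\<Sum>m\<le>?M. (?F m ?M + ?F m N) * ?phi m)"
    unfolding shift[symmetric] sum_subtractf[symmetric]
    by (intro sum.cong refl) (simp only: cheb_fps_recurrence[OF nz q] left_diff_distrib)
  also have "\<dots> = poly (cheb_poly a q ?M) x + poly (cheb_poly a q N) x"
    by (simp only: ev[of ?M] ev[of N] le_refl le_SucI sum.distrib[symmetric] distrib_right)
  finally show "poly (cheb_poly a q ?M) x + poly (cheb_poly a q N) x = 2 * x * poly (cheb_poly a q (Suc N)) x"
    by simp
qed

section \<open>Ballot numbers and powers of 2x\<close>

text \<open>The multiplicity of U_(n-2s) in (2x)^n when 2s \<le> n. The integer lower index makes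
  the subtracted binomial 0 at s = 0, where truncated subtraction would give 1.\<close>

definition ballot :: "nat \<Rightarrow> nat \<Rightarrow> int" where
  "ballot n s = zbinom n (int s) - zbinom n (int s - 1)"

lemma zbinom_Suc: "zbinom (Suc n) k = zbinom n k + zbinom n (k - 1)"
proof (cases "k \<le> 0")
  case False
  then have "nat k = Suc (nat (k - 1))" by simp
  then show ?thesis using False by (simp add: zbinom_def)
qed (auto simp: zbinom_def)

lemma ballot_Suc: "ballot (Suc n) (Suc s) = ballot n (Suc s) + ballot n s"
  by (simp add: ballot_def zbinom_Suc)

lemma ballot_Suc_0: "ballot (Suc n) 0 = ballot n 0"
  by (simp add: ballot_def zbinom_def)

text \<open>Symmetry of the binomials, as n - s = s - 1. It removes the one boundary term in the
  induction for (2x)^n.\<close>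

lemma ballot_eq_0:
  assumes "Suc n = 2 * s"
  shows "ballot n s = 0"
proof -
  have "n choose s = n choose (n - s)"
    using assms by (intro binomial_symmetric) simp
  also have "n - s = s - 1" using assms by simp
  finally show ?thesis using assms by (auto simp: ballot_def zbinom_def nat_diff_distrib)
qed

text \<open>Multiplying by 2x sends U_N to U_(N+1) + U_(N-1), which matches the Pascal rule
  \<open>ballot_Suc\<close>.\<close>

lemma power_eq_ballot_sum:
  fixes a q :: "'a::field_char_0"
  assumes nz: "a \<noteq> 0" "q \<noteq> 0" and q: "\<And>k::nat. k \<ge> 1 \<Longrightarrow> q ^ k \<noteq> 1"
  shows "(2 * x) ^ n = (\<Sum>s\<le>Suc n. of_int (ballot n s) * (if 2 * s \<le> n then poly (cheb_poly a q (n - 2 * s)) x else 0))"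
proof (induction n)
  case 0
  show ?case using cheb_poly_recurrence(1)[OF nz q] by (simp add: ballot_def zbinom_def)
next
  case (Suc n)
  define w where "w = (\<lambda>n s. if 2 * s \<le> n then poly (cheb_poly a q (n - 2 * s)) x else 0)"
  have step: "of_int (ballot n s) * (2 * x * w n s) = of_int (ballot n s) * (w (Suc n) s + w (Suc n) (Suc s))" for s
  proof (cases "2 * s \<le> n")
    case True
    define N where "N = n - 2 * s"
    have n: "n = 2 * s + N" using True by (simp add: N_def)
    have "2 * x * w n s = w (Suc n) s + w (Suc n) (Suc s)"
    proof (cases N)
      case 0
      then show ?thesis using cheb_poly_recurrence(1,2)[OF nz q, where x = x] by (simp add: n w_def)
    next
      case (Suc N')
      then show ?thesis using cheb_poly_recurrence(3)[OF nz q, where x = x and N = N'] by (simp add: n w_def Suc_diff_le)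
    qed
    then show ?thesis by simp
  next
    case False
    show ?thesis
    \<comment> \<open>If 2s = n + 1 then \<open>w n s\<close> is 0 but \<open>w (Suc n) s\<close> is
      U_0 = 1; the equation is saved by the vanishing ballot number.\<close>
    proof (cases "Suc n = 2 * s")
      case True
      then show ?thesis by (simp add: ballot_eq_0)
    next
      case F: False
      with False show ?thesis by (simp add: w_def)
    qed
  qed
  have w0: "w (Suc n) (Suc (Suc n)) = 0" by (simp add: w_def)
  have "(2 * x) ^ Suc n = (\<Sum>s\<le>Suc n. of_int (ballot n s) * (2 * x * w n s))"
    unfolding power_Suc Suc w_def by (simp only: sum_distrib_left mult_ac)
  also have "\<dots> = (\<Sum>s\<le>Suc n. of_int (ballot n s) * w (Suc n) s) + (\<Sum>s\<le>Suc n. of_int (ballot n s) * w (Suc n) (Suc s))"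
    unfolding step by (simp only: sum.distrib distrib_left)
  also have "(\<Sum>s\<le>Suc n. of_int (ballot n s) * w (Suc n) s) = (\<Sum>s\<le>Suc (Suc n). of_int (ballot n s) * w (Suc n) s)"
    using w0 by simp
  also have "\<dots> = of_int (ballot n 0) * w (Suc n) 0 + (\<Sum>s\<le>Suc n. of_int (ballot n (Suc s)) * w (Suc n) (Suc s))"
    by (rule sum.atMost_Suc_shift)
  also have "\<dots> + (\<Sum>s\<le>Suc n. of_int (ballot n s) * w (Suc n) (Suc s)) = (\<Sum>s\<le>Suc (Suc n). of_int (ballot (Suc n) s) * w (Suc n) s)"
    unfolding sum.atMost_Suc_shift[of _ "Suc n"] ballot_Suc ballot_Suc_0
    by (simp only: of_int_add distrib_right sum.distrib add.assoc)
  finally show ?case unfolding w_def .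
qed

section \<open>Explicit coefficients and the moment formula\<close>

lemma two_times_choose_two: "2 * int (m choose 2) = int m * int m - int m"
  by (induction m) (simp_all add: numeral_2_eq_2 algebra_simps)

text \<open>The Cauchy product of the two \<open>q\<close>-binomial series at degree N - m, with
  signs and exponents collected. The index set is empty for m > N, where a bound p \<le> N - m would
  keep p = 0.\<close>

lemma cheb_fps_nth:
  fixes a q :: "'a::field"
  assumes nz: "a \<noteq> 0" "q \<noteq> 0"
  shows "cheb_fps a q m $ N = (- q) ^ m * (\<Sum>p | m + p \<le> N. a powi (- int N + 2 * int p) *
      qbinom q (m + p) m * qbinom q (N - p) m * q powi ((- int N + int p) * int m + int (m choose 2)))"
proof (cases "m \<le> N")
  case False
  then show ?thesis by (simp add: cheb_fps_eq_0)
next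
  case True
  have "(\<Prod>i<m. - inverse (a * q ^ i)) = (- 1) ^ m * inverse (a ^ m) * inverse (q ^ (m choose 2))"
  proof (induction m)
    case (Suc m)
    have "Suc m choose 2 = (m choose 2) + m" by (simp add: numeral_2_eq_2)
    then show ?case using Suc by (simp add: power_add mult_ac)
  qed (simp add: numeral_2_eq_2)
  then have k: "(\<Prod>i<m. - inverse (a * q ^ i)) = (- 1) ^ m * a powi (- int m) * q powi (- int (m choose 2))"
    by (simp add: power_int_minus)
  have set: "{p. m + p \<le> N} = {0..N - m}" using True by auto
  have "(\<Prod>i<m. - inverse (a * q ^ i)) * (qbinom q (m + p) m * a ^ p * (qbinom q (m + (N - m - p)) m * inverse (a * q ^ m) ^ (N - m - p)))
    = (- q) ^ m * (a powi (- int N + 2 * int p) *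
      qbinom q (m + p) m * qbinom q (N - p) m * q powi ((- int N + int p) * int m + int (m choose 2)))"
    if "p \<le> N - m" for p
  proof -
    define j where "j = N - m - p"
    have N: "N = m + p + j" using that True by (simp add: j_def)
    have ha: "a powi (- int N + 2 * int p) = a powi (- int m) * a ^ p * inverse a ^ j"
    proof -
      have "- int N + 2 * int p = - int m + (int p + - int j)" by (simp add: N)
      then show ?thesis using nz
        by (simp only: power_int_add power_int_minus power_int_of_nat power_inverse mult.assoc
            not_False_eq_True simp_thms)
    qed
    \<comment> \<open>The factor q^m comes from (-q)^m; the exponents agree by m^2 - m = 2 (m choose
      2).\<close>
    have hq: "q powi ((- int N + int p) * int m + int (m choose 2)) * q ^ m = q powi (- int (m choose 2)) * inverse (q ^ m) ^ j"
    proof -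
      have "(- int N + int p) * int m + int (m choose 2) + int m = - int (m choose 2) + - int (m * j)"
        using two_times_choose_two[of m] by (simp add: N algebra_simps)
      then have "q powi ((- int N + int p) * int m + int (m choose 2)) * q powi int m = q powi (- int (m choose 2)) * q powi (- int (m * j))"
        using nz by (simp only: power_int_add[symmetric] simp_thms)
      then show ?thesis by (simp only: power_int_minus power_int_of_nat power_inverse power_mult)
    qed
    have hN: "N - p = m + j" "N - m - p = j" using N by auto
    have hs: "(- q) ^ m = (- 1) ^ m * q ^ m" by (rule power_minus)
    have h: "u * v * w * (x * y * (x' * (z * r))) = u * t * (v * y * z * x * x' * Z)"
      if "Z * t = w * r" for u v w x y x' z r t Z :: 'a
    proof -
      have "u * v * w * (x * y * (x' * (z * r))) = u * v * x * y * x' * z * (w * r)"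
        by (simp only: mult_ac)
      also have "\<dots> = u * t * (v * y * z * x * x' * Z)"
        unfolding that[symmetric] by (simp only: mult_ac)
      finally show ?thesis .
    qed
    show ?thesis unfolding k hN ha hs unfolding inverse_mult_distrib power_mult_distrib
      by (rule h[OF hq])
  qed
  then have eq: "(\<Sum>p=0..N-m. (\<Prod>i<m. - inverse (a * q ^ i)) *
      (qbinom q (m + p) m * a ^ p * (qbinom q (m + (N - m - p)) m * inverse (a * q ^ m) ^ (N - m - p))))
    = (\<Sum>p=0..N-m. (- q) ^ m * (a powi (- int N + 2 * int p) *
      qbinom q (m + p) m * qbinom q (N - p) m * q powi ((- int N + int p) * int m + int (m choose 2))))"
    by (intro sum.cong) simp_all
  have "(fps_X ^ m * f) $ N = f $ (N - m)" for f :: "'a fps"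
    using True by (simp add: fps_X_power_mult_nth)
  then have "cheb_fps a q m $ N = (\<Prod>i<m. - inverse (a * q ^ i)) *
      (qbinom_fps q m a * qbinom_fps q m (inverse (a * q ^ m))) $ (N - m)"
    unfolding cheb_fps_def fps_mult_left_const_nth by (simp only:)
  then show ?thesis
    unfolding fps_mult_nth qbinom_fps_def fps_nth_Abs_fps set sum_distrib_left eq .
qed

theorem theorem2p2:
  fixes a b c d q :: "'a::field_char_0" and n :: nat
  assumes "a \<noteq> 0" and "q \<noteq> 0"
    and "\<And>k::nat. k \<ge> 1 \<Longrightarrow> q ^ k \<noteq> 1"
    and "\<And>k::nat. a * b * c * d * q ^ k \<noteq> 1"
  shows "2 ^ n * AW_moment n a b c d q =
    (\<Sum>m=0..n.
       qpoch (a*b) q m * qpoch (a*c) q m * qpoch (a*d) q m / qpoch (a*b*c*d) q m * (- q) ^ m *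
       (\<Sum>s=0..n + 1. of_int (zbinom n (int s) - zbinom n (int s - 1)) *
          (\<Sum>p | 2 * s + m + p \<le> n.
             a powi (- int n + 2 * int s + 2 * int p) *
             qbinom q (m + p) m * qbinom q (n - 2 * s - p) m *
             q powi ((- int n + 2 * int s + int p) * int m + int (m choose 2)))))"
proof -
  note nz = assms(1,2) and q = assms(3) and abcd = assms(4)
  define L where "L = AW_functional a b c d q"
  have L: "is_AW_functional a b c d q L" unfolding L_def by (rule AW_functional_is)
  have lin: "L (p + r) = L p + L r" "L (smult x p) = x * L p" for p r x
    using L unfolding is_AW_functional_def linear_smult_iff by auto
  have L0: "L 0 = 0" using lin(2)[of 0 0] by simp
  have Lsum: "L (sum f S) = (\<Sum>x\<in>S. L (f x))" if "finite S" for f and S :: "nat set"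
    using that by (induction S rule: finite_induct) (simp_all add: L0 lin)
  define G where "G = (\<lambda>m. qpoch (a*b) q m * qpoch (a*c) q m * qpoch (a*d) q m / qpoch (a*b*c*d) q m)"
  define S where "S = (\<lambda>s m. \<Sum>p | 2 * s + m + p \<le> n.
             a powi (- int n + 2 * int s + 2 * int p) *
             qbinom q (m + p) m * qbinom q (n - 2 * s - p) m *
             q powi ((- int n + 2 * int s + int p) * int m + int (m choose 2)))"
  \<comment> \<open>The range m \<le> n does not depend on \<open>s\<close>, so that the two sums
    can be interchanged later; terms with m > n - 2s are 0.\<close>
  have U: "L (if 2 * s \<le> n then cheb_poly a q (n - 2 * s) else 0) = (\<Sum>m\<le>n. G m * (- q) ^ m * S s m)" for s
  proof (cases "2 * s \<le> n")
    case True
    have "cheb_fps a q m $ (n - 2 * s) = (- q) ^ m * S s m" for m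
    proof -
      have "{p. m + p \<le> n - 2 * s} = {p. 2 * s + m + p \<le> n}" "- int (n - 2 * s) = - int n + 2 * int s"
        using True by auto
      then show ?thesis unfolding cheb_fps_nth[OF nz] S_def by (simp only:)
    qed
    then have "L (cheb_poly a q (n - 2 * s)) = (\<Sum>m\<le>n. (- q) ^ m * S s m * G m)"
      by (simp add: cheb_poly_extend[of "n - 2 * s" n] Lsum lin AW_functional_phi[OF nz q abcd L] G_def)
    then show ?thesis using True by (simp add: mult_ac)
  next
    case False
    then have "S s m = 0" for m by (simp add: S_def)
    then show ?thesis using False by (simp add: L0)
  qed
  \<comment> \<open>Over an infinite field equality of values at all points gives equality of
    polynomials, to which \<open>L\<close> can be applied.\<close>
  have "smult (2 ^ n) (monom 1 n) =
      (\<Sum>s\<le>Suc n. smult (of_int (ballot n s)) (if 2 * s \<le> n then cheb_poly a q (n - 2 * s) else 0))"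
  proof -
    have "poly (if Q then p else 0) x = (if Q then poly p x else 0)" for Q and p :: "'a poly" and x
      by simp
    then show ?thesis
      using power_eq_ballot_sum[OF nz q, of _ n]
      unfolding poly_eq_poly_eq_iff[symmetric] fun_eq_iff
      by (simp only: poly_smult poly_monom poly_sum power_mult_distrib mult_1_left simp_thms)
  qed
  then have "2 ^ n * AW_moment n a b c d q =
      L (\<Sum>s\<le>Suc n. smult (of_int (ballot n s)) (if 2 * s \<le> n then cheb_poly a q (n - 2 * s) else 0))"
    unfolding AW_moment_def L_def[symmetric] lin(2)[symmetric] by (simp only:)
  also have "\<dots> = (\<Sum>s\<le>Suc n. of_int (ballot n s) * (\<Sum>m\<le>n. G m * (- q) ^ m * S s m))"
    by (simp only: Lsum finite_atMost lin(2) U)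
  also have "\<dots> = (\<Sum>m\<le>n. G m * (- q) ^ m * (\<Sum>s\<le>Suc n. of_int (ballot n s) * S s m))"
    unfolding sum_distrib_left by (subst sum.swap) (simp only: mult_ac)
  finally show ?thesis
    unfolding G_def S_def ballot_def by (simp only: atLeast0AtMost Suc_eq_plus1)
qed

end
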